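(* As $n\to\infty$, \[\mathrm{ex}_3(n,\mathrm{Tr}(C_4))\le \frac{1+\sqrt{2}}{4}\,n^{3/2}+o(n^{3/2}).\]
   Context: $C_4$ is the cycle of length four. For a graph $F$ and an integer $r\ge 2$, $\mathrm{Tr}(F)$ denotes the family of $r$-uniform hypergraphs $\mathcal{F}$ for which $V(F)\subseteq V(\mathcal{F})$ and there is a bijection $f$ from the edges of $F$ to the hyperedges of $\mathcal{F}$ with $f(e)\cap V(F)=e$ for every edge $e$ of $F$ (each edge of $F$ is enlarged to a hyperedge using only vertices outside $V(F)$). An $r$-uniform hypergraph is $\mathrm{Tr}(F)$-free if it contains no subhypergraph isomorphic to a member of $\mathrm{Tr}(F)$. $\mathrm{ex}_r(n,\mathrm{Tr}(F))$ is the maximum number of hyperedges in an $n$-vertex $r$-uniform $\mathrm{Tr}(F)$-free hypergraph. Here $r=3$. *)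

theory Defs
  imports Complex_Main
begin

definition uniform_hypergraph :: "nat \<Rightarrow> 'a set \<Rightarrow> 'a set set \<Rightarrow> bool" where
  "uniform_hypergraph r V H \<longleftrightarrow> (\<forall>h\<in>H. h \<subseteq> V \<and> card h = r)"

definition contains_Tr_C4 :: "'a set set \<Rightarrow> bool" where
  "contains_Tr_C4 H \<longleftrightarrow> (\<exists>a b c d h1 h2 h3 h4.
     distinct [a, b, c, d] \<and> distinct [h1, h2, h3, h4] \<and>
     h1 \<in> H \<and> h2 \<in> H \<and> h3 \<in> H \<and> h4 \<in> H \<and>
     h1 \<inter> {a, b, c, d} = {a, b} \<and> h2 \<inter> {a, b, c, d} = {b, c} \<and>
     h3 \<inter> {a, b, c, d} = {c, d} \<and> h4 \<inter> {a, b, c, d} = {d, a})"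

definition ex_Tr_C4 :: "nat \<Rightarrow> nat \<Rightarrow> nat" where
  "ex_Tr_C4 r n = Max {card H | H :: nat set set.
      uniform_hypergraph r {..<n} H \<and> \<not> contains_Tr_C4 H}"

end

theory Submission
  imports Defs "HOL-Analysis.Analysis"
begin

text \<open>
  Call a pair of vertices light if it lies in exactly one hyperedge. Let \<open>core\<close> consist of the
  hyperedges without a light pair and let \<open>D\<close> be their shadow; let \<open>A\<close> contain one light pair of
  each of the other hyperedges. No pair lies in three core hyperedges, so giving the pairs in \<open>A\<close>
  weight \<open>1\<close> and those in \<open>D\<close> weight \<open>2 / 3\<close> yields a total weight of at least the number of
  hyperedges.

  For vertices \<open>a \<noteq> c\<close> consider the paths \<open>a b c\<close> of weighted pairs with \<open>{a, b, c}\<close> not a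
  hyperedge. There is at most one of each of the types \<open>AA\<close>, \<open>AD\<close>, \<open>DA\<close>, \<open>DD\<close>, because a
  four-cycle fails to extend to a trace only through a light pair in \<open>A\<close> whose hyperedge runs along
  the cycle. Up to linearly many (in the number of hyperedges) exceptional pairs, a mixed type
  (\<open>AD\<close> or \<open>DA\<close>) does not occur together with \<open>AA\<close> or \<open>DD\<close>. Hence the products of the
  weights along the paths sum to at most \<open>max (1 + 4/9) (2 \<cdot> 2/3) = 13/9\<close>. With \<open>w\<close> the
  weighted degree, summing over all \<open>(a, c)\<close> bounds \<open>\<Sum> w\<^sup>2\<close> by \<open>13/9 n\<^sup>2\<close> plus lower-order
  terms, and Cauchy--Schwarz gives at most \<open>(sqrt 13 / 6 + o(1)) n powr (3/2)\<close> hyperedges, where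
  \<open>sqrt 13 / 6 < (1 + sqrt 2) / 4\<close>.
\<close>

lemma sum_of_bool_pairs:
  assumes "finite V"
  shows "(\<Sum>u\<in>V. \<Sum>v\<in>V. of_bool (R u v)) =
    real (card {(u, v). u \<in> V \<and> v \<in> V \<and> R u v})"
proof -
  have "{p \<in> V \<times> V. case p of (u, v) \<Rightarrow> R u v} = {(u, v). u \<in> V \<and> v \<in> V \<and> R u v}" by auto
  moreover have "(\<Sum>u\<in>V. \<Sum>v\<in>V. of_bool (R u v)) =
      (\<Sum>p\<in>V \<times> V. of_bool (case p of (u, v) \<Rightarrow> R u v) :: real)"
    unfolding sum.cartesian_product by (intro sum.cong) auto
  ultimately show ?thesis using assms by (simp add: Int_def)
qed

section \<open>Links, core hyperedges and the two kinds of weighted pairs\<close>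

locale trace_free =
  fixes V :: "'a set" and H :: "'a set set"
  assumes finite_V: "finite V"
    and uniform: "uniform_hypergraph 3 V H"
    and free: "\<not> contains_Tr_C4 H"
begin

definition link :: "'a \<Rightarrow> 'a \<Rightarrow> 'a set" where
  "link u v = {w. {u, v, w} \<in> H}"

definition rich :: "'a \<Rightarrow> 'a \<Rightarrow> bool" where
  "rich u v \<longleftrightarrow> (\<exists>x\<in>link u v. \<exists>y\<in>link u v. x \<noteq> y)"

text \<open>As \<open>w\<close> lies in \<open>link u v\<close> anyway,
  \<open>link u v \<noteq> {w}\<close> says that a second hyperedge contains the pair; all orderings
  of \<open>h\<close>, hence all three pairs, are tested.\<close>

definition core :: "'a set set" where
  "core = {h \<in> H. \<forall>u v w. h = {u, v, w} \<longrightarrow> link u v \<noteq> {w}}"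

text \<open>The choice is meaningful only for \<open>h\<close> outside \<open>core\<close>. It is an
  ordered pair, so \<open>A\<close> symmetrises it.\<close>

definition private_pair :: "'a set \<Rightarrow> 'a \<times> 'a" where
  "private_pair h = (SOME p. \<exists>w. h = {fst p, snd p, w} \<and> link (fst p) (snd p) = {w})"

definition A :: "'a \<Rightarrow> 'a \<Rightarrow> bool" where
  "A u v \<longleftrightarrow> (\<exists>h\<in>H - core. private_pair h = (u, v) \<or> private_pair h = (v, u))"

definition D :: "'a \<Rightarrow> 'a \<Rightarrow> bool" where
  "D u v \<longleftrightarrow> (\<exists>w. {u, v, w} \<in> core)"

lemma edge_subset: "h \<in> H \<Longrightarrow> h \<subseteq> V"
  and edge_card: "h \<in> H \<Longrightarrow> card h = 3"
  using uniform by (auto simp: uniform_hypergraph_def)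

lemma finite_H: "finite H"
  using edge_subset finite_V by (meson Pow_iff finite_Pow_iff finite_subset subsetI)

lemma edge_distinct:
  assumes "{u, v, w} \<in> H"
  shows "u \<noteq> v" "u \<noteq> w" "v \<noteq> w" "u \<in> V" "v \<in> V" "w \<in> V"
  using edge_card[OF assms] edge_subset[OF assms]
  by (auto simp: card_insert_if split: if_splits)

lemma link_sym: "link u v = link v u"
  by (simp add: link_def insert_commute)

lemma link_rotate: "w \<in> link u v \<longleftrightarrow> u \<in> link v w"
  by (simp add: link_def insert_commute)

lemma link_distinct:
  assumes "w \<in> link u v"
  shows "u \<noteq> v" "u \<noteq> w" "v \<noteq> w" "u \<in> V" "v \<in> V" "w \<in> V"
  using assms edge_distinct unfolding link_def by blast+

section \<open>Four-cycles that extend to a trace\<close>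

lemma four_cycle:
  assumes "distinct [a, b, c, d]"
    and "p \<in> link a b" "p \<notin> {c, d}"
    and "q \<in> link b c" "q \<notin> {a, d}"
    and "r \<in> link c d" "r \<notin> {a, b}"
    and "s \<in> link d a" "s \<notin> {b, c}"
  shows False
proof -
  have m: "{a, b, p} \<in> H" "{b, c, q} \<in> H" "{c, d, r} \<in> H" "{d, a, s} \<in> H"
    using assms by (auto simp: link_def)
  have t: "{a, b, p} \<inter> {a, b, c, d} = {a, b}" "{b, c, q} \<inter> {a, b, c, d} = {b, c}"
    "{c, d, r} \<inter> {a, b, c, d} = {c, d}" "{d, a, s} \<inter> {a, b, c, d} = {d, a}"
    using assms link_distinct[OF assms(2)] link_distinct[OF assms(4)]
      link_distinct[OF assms(6)] link_distinct[OF assms(8)] by auto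
  have "distinct [{a, b, p}, {b, c, q}, {c, d, r}, {d, a, s}]"
  proof -
    \<comment> \<open>The extending vertices may coincide; the hyperedges differ because they meet
      the cycle in different sides.\<close>
    have "distinct (map (\<lambda>h. h \<inter> {a, b, c, d}) [{a, b, p}, {b, c, q}, {c, d, r}, {d, a, s}])"
      using assms(1) unfolding list.map t by (auto simp: doubleton_eq_iff)
    then show ?thesis unfolding distinct_map by blast
  qed
  then show False
    using free m t assms(1) unfolding contains_Tr_C4_def by blast
qed

lemma three_rich_pages:
  assumes d: "distinct [w1, w2, w3]"
    and p: "w1 \<in> link u v" "w2 \<in> link u v" "w3 \<in> link u v"
    and ru: "rich u w1" "rich u w2" "rich u w3"
    and rv: "rich v w1" "rich v w2" "rich v w3"
  shows False
proof -
  \<comment> \<open>\<open>X\<close> records extensions outside the five vertices; the trace-freeness of their 15 four-cycles is then a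
    propositional contradiction.\<close>
  define X where "X e \<longleftrightarrow> (\<exists>y. y \<notin> {u, v, w1, w2, w3} \<and> insert y e \<in> H)" for e
  have five: "distinct [u, v, w1, w2, w3]"
    using d p link_distinct by auto
  have mem: "y \<in> link a b \<longleftrightarrow> insert y {a, b} \<in> H" for y a b
    by (simp add: link_def insert_commute)
  \<comment> \<open>A side extends admissibly either outside the five vertices or by the omitted
    vertex \<open>f\<close>; \<open>four_cycle\<close> forbids this for all four sides at
    once.\<close>
  have cycle: "\<not> ((X {a, b} \<or> {a, b, f} \<in> H) \<and> (X {b, c} \<or> {b, c, f} \<in> H) \<and>
      (X {c, e} \<or> {c, e, f} \<in> H) \<and> (X {e, a} \<or> {e, a, f} \<in> H))"
    if s: "{a, b, c, e, f} = {u, v, w1, w2, w3}" "distinct [a, b, c, e, f]" for a b c e f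
  proof -
    have ex: "\<exists>y\<in>link p q. y \<notin> {r, t}"
      if "X {p, q} \<or> {p, q, f} \<in> H" "r \<in> {a, b, c, e}" "t \<in> {a, b, c, e}" for p q r t
      using that(1)
    proof
      assume "X {p, q}"
      then obtain y where y: "y \<notin> {a, b, c, e, f}" "insert y {p, q} \<in> H"
        unfolding X_def s(1) by blast
      have "y \<notin> {r, t}"
        using y(1) that(2,3) by blast
      moreover have "y \<in> link p q" using y(2) mem by simp
      ultimately show ?thesis by (rule bexI)
    next
      assume "{p, q, f} \<in> H"
      then have "f \<in> link p q" by (simp add: link_def)
      moreover have "f \<notin> {a, b, c, e}" using s(2) by auto
      then have "f \<notin> {r, t}" using that(2,3) by blast
      ultimately show ?thesis by blast
    qed
    show ?thesis
      using ex[of a b c e] ex[of b c a e] ex[of c e a b] ex[of e a b c]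
        four_cycle[of a b c e] s(2) by auto
  qed
  \<comment> \<open>A rich pair \<open>{s, w}\<close> has a hyperedge besides the page
    \<open>{s, s', w}\<close>; its third vertex is another page vertex or lies outside.\<close>
  have other: "X {s, w} \<or> {s, w, y} \<in> H \<or> {s, w, z} \<in> H"
    if rs: "rich s w" and eq: "{s, s', w, y, z} = {u, v, w1, w2, w3}" for s s' w y z
  proof -
    obtain r where r: "r \<in> link s w" "r \<noteq> s'" using rs unfolding rich_def by metis
    then have "r \<noteq> s" "r \<noteq> w" using link_distinct[OF r(1)] by auto
    have "{s, w, r} \<in> H" using r(1) by (simp add: link_def)
    show ?thesis
    proof (cases "r \<in> {s, s', w, y, z}")
      case True
      then show ?thesis using r(2) \<open>r \<noteq> s\<close> \<open>r \<noteq> w\<close> \<open>{s, w, r} \<in> H\<close> by blast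
    next
      case False
      then show ?thesis using r(1) unfolding X_def eq[symmetric] mem by blast
    qed
  qed
  have distincts: "u \<noteq> v" "u \<noteq> w1" "u \<noteq> w2" "u \<noteq> w3" "v \<noteq> w1" "v \<noteq> w2" "v \<noteq> w3"
    "w1 \<noteq> w2" "w1 \<noteq> w3" "w2 \<noteq> w3"
    using five by auto
  have pages: "{u, v, w1} \<in> H" "{u, v, w2} \<in> H" "{u, v, w3} \<in> H"
    using p by (simp_all add: link_def)
  \<comment> \<open>Three cycles for each of the five omitted vertices.\<close>
  note cycles = cycle[of u v w1 w2 w3] cycle[of u w1 v w2 w3] cycle[of u v w2 w1 w3]
    cycle[of u v w1 w3 w2] cycle[of u w1 v w3 w2] cycle[of u v w3 w1 w2]
    cycle[of u v w2 w3 w1] cycle[of u w2 v w3 w1] cycle[of u v w3 w2 w1]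
    cycle[of u w1 w2 w3 v] cycle[of u w2 w1 w3 v] cycle[of u w1 w3 w2 v]
    cycle[of v w1 w2 w3 u] cycle[of v w2 w1 w3 u] cycle[of v w1 w3 w2 u]
  note others = other[of u w1 v w2 w3] other[of u w2 v w1 w3] other[of u w3 v w1 w2]
    other[of v w1 u w2 w3] other[of v w2 u w1 w3] other[of v w3 u w1 w2]
  show False
    using cycles others pages ru rv
    by (simp only: insert_commute distincts distincts[symmetric] distinct.simps list.set
        insert_iff empty_iff simp_thms True_implies_equals) argo
qed

section \<open>Compatibility of \<open>A\<close> and \<open>D\<close> along hyperedges and
  four-cycles\<close>

lemma A_sym: "A u v \<longleftrightarrow> A v u"
  by (auto simp: A_def)

lemma D_sym: "D u v \<longleftrightarrow> D v u"
  by (simp add: D_def insert_commute)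

lemma private_pairE:
  assumes "h \<in> H - core" "private_pair h = (u, v)"
  obtains w where "h = {u, v, w}" "link u v = {w}"
proof -
  obtain u' v' w' where "h = {u', v', w'}" "link u' v' = {w'}"
    using assms(1) by (auto simp: core_def)
  then have "\<exists>p w. h = {fst p, snd p, w} \<and> link (fst p) (snd p) = {w}"
    by (metis fst_conv snd_conv)
  then have "\<exists>w. h = {fst (private_pair h), snd (private_pair h), w} \<and>
      link (fst (private_pair h)) (snd (private_pair h)) = {w}"
    unfolding private_pair_def by (rule someI_ex)
  then show thesis using assms(2) that by auto
qed

lemma A_E:
  assumes "A u v"
  obtains w where "link u v = {w}" "{u, v, w} \<in> H - core"
    "private_pair {u, v, w} = (u, v) \<or> private_pair {u, v, w} = (v, u)"
proof -
  obtain h where h: "h \<in> H - core" "private_pair h = (u, v) \<or> private_pair h = (v, u)"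
    using assms by (auto simp: A_def)
  from h(2) obtain w where "h = {u, v, w}" "link u v = {w}"
  proof
    assume "private_pair h = (u, v)"
    from private_pairE[OF h(1) this] that show thesis by metis
  next
    assume "private_pair h = (v, u)"
    from private_pairE[OF h(1) this] obtain w where "h = {v, u, w}" "link v u = {w}" .
    with that[of w] show thesis by (simp add: link_sym[of u v] insert_commute)
  qed
  with h that show thesis by simp
qed

text \<open>Both pairs would be light with the same hyperedge \<open>{u, v, w}\<close>, which
  contributes only its one private pair.\<close>

lemma A_link_unique:
  assumes "A u v" "w \<in> link u v"
  shows "\<not> A u w"
proof
  assume "A u w"
  then obtain x where x: "link u w = {x}"
    "private_pair {u, w, x} = (u, w) \<or> private_pair {u, w, x} = (w, u)"
    by (rule A_E)
  have "v \<in> link u w" using assms(2) by (simp add: link_def insert_commute)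
  then have "x = v" using x by auto
  obtain y where y: "link u v = {y}"
    "private_pair {u, v, y} = (u, v) \<or> private_pair {u, v, y} = (v, u)"
    using assms(1) by (rule A_E)
  have "y = w" using y assms by auto
  have "{u, w, x} = {u, v, y}" using \<open>x = v\<close> \<open>y = w\<close> by auto
  then have "private_pair {u, v, y} = (u, w) \<or> private_pair {u, v, y} = (w, u)" using x(2) by simp
  then show False using y(2) link_distinct[OF assms(2)] by (metis prod.inject)
qed

lemma D_rich:
  assumes "D u v" shows "rich u v"
proof -
  obtain w where w: "{u, v, w} \<in> core" using assms by (auto simp: D_def)
  then have "w \<in> link u v" "link u v \<noteq> {w}" by (auto simp: core_def link_def)
  then show ?thesis unfolding rich_def by blast
qed

lemma A_not_D: "A u v \<Longrightarrow> \<not> D u v"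
  using A_E D_rich unfolding rich_def by (metis singletonD)

lemma A_or_D_link: "A u v \<or> D u v \<Longrightarrow> link u v \<noteq> {}"
  using A_E D_rich unfolding rich_def by (metis empty_iff insert_not_empty)

text \<open>Pairs in \<open>D\<close> are rich, so a singleton link forces \<open>A\<close>; then
  \<open>A_link_unique\<close> leaves only \<open>D\<close> for the other pair.\<close>

lemma singleton_link:
  assumes "A u v \<or> D u v" "A u w \<or> D u w" "link u v = {w}"
  shows "A u v" "D u w"
proof -
  show "A u v" using assms D_rich unfolding rich_def by (metis singletonD)
  then show "D u w" using assms A_link_unique by blast
qed

text \<open>In the four-cycle \<open>a b c b'\<close> some side fails to extend. As neither
  \<open>{a, b, c}\<close> nor \<open>{a, b', c}\<close> is a hyperedge, a side such as
  \<open>a b\<close> fails only if \<open>link a b = {b'}\<close>; \<open>singleton_link\<close>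
  then gives the types of \<open>a b\<close> and \<open>a b'\<close>.\<close>

lemma two_paths:
  assumes "a \<noteq> c" "b \<noteq> b'" "b \<notin> link a c" "b' \<notin> link a c"
    and ab: "A a b \<or> D a b" and cb: "A c b \<or> D c b"
    and ab': "A a b' \<or> D a b'" and cb': "A c b' \<or> D c b'"
  shows "(A a b \<and> D a b' \<and> link a b = {b'}) \<or> (A c b \<and> D c b' \<and> link c b = {b'}) \<or>
    (A a b' \<and> D a b \<and> link a b' = {b}) \<or> (A c b' \<and> D c b \<and> link c b' = {b})"
proof -
  have ne: "a \<noteq> b" "b \<noteq> c" "c \<noteq> b'" "b' \<noteq> a"
    using A_or_D_link[OF ab] A_or_D_link[OF cb] A_or_D_link[OF ab'] A_or_D_link[OF cb']
      link_distinct by blast+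
  have nc: "c \<notin> link a b" "a \<notin> link c b" "c \<notin> link a b'" "a \<notin> link c b'"
    using assms(3,4) by (auto simp: link_def insert_commute)
  have dis: "distinct [a, b, c, b']" using ne assms(1,2) by auto
  have "link a b = {b'} \<or> link c b = {b'} \<or> link a b' = {b} \<or> link c b' = {b}"
  proof (rule ccontr)
    assume n: "\<not> ?thesis"
    have other: "\<exists>p\<in>X. p \<notin> {y, z}" if "X \<noteq> {}" "X \<noteq> {z}" "y \<notin> X" for X and y z :: 'a
      using that by auto
    have "\<exists>p\<in>link a b. p \<notin> {c, b'}" using n nc other A_or_D_link[OF ab] by blast
    moreover have "\<exists>p\<in>link b c. p \<notin> {a, b'}"
      using n nc other A_or_D_link[OF cb] link_sym[of b c] by blast
    moreover have "\<exists>p\<in>link c b'. p \<notin> {a, b}" using n nc other A_or_D_link[OF cb'] by blast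
    moreover have "\<exists>p\<in>link b' a. p \<notin> {b, c}"
      using n nc other A_or_D_link[OF ab'] link_sym[of b' a] by blast
    ultimately show False using four_cycle[OF dis] by blast
  qed
  then show ?thesis
    using singleton_link[OF ab ab'] singleton_link[OF cb cb']
      singleton_link[OF ab' ab] singleton_link[OF cb' cb] by (elim disjE) simp_all
qed

section \<open>Counting common neighbours\<close>

lemma card_le_oneI:
  assumes "\<And>x y. x \<in> X \<Longrightarrow> y \<in> X \<Longrightarrow> x = y"
  shows "card X \<le> 1"
  using assms by (metis One_nat_def card.infinite card_le_Suc0_iff_eq le0)

text \<open>Each alternative of \<open>two_paths\<close> puts the two pairs at one end into
  different classes, so two paths of equal type contradict \<open>A_not_D\<close>. Type
  \<open>DA\<close> is \<open>AD\<close> with the ends exchanged.\<close>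

lemma card_paths_le_one:
  assumes "a \<noteq> c"
  shows "card {b. b \<notin> link a c \<and> A a b \<and> A c b} \<le> 1"
    and "card {b. b \<notin> link a c \<and> A a b \<and> D c b} \<le> 1"
    and "card {b. b \<notin> link a c \<and> D a b \<and> D c b} \<le> 1"
  by (rule card_le_oneI, use two_paths[OF assms] A_not_D in blast)+

lemma card_le_twoI:
  assumes "\<And>x y z. distinct [x, y, z] \<Longrightarrow> x \<in> X \<Longrightarrow> y \<in> X \<Longrightarrow> z \<in> X \<Longrightarrow> False"
  shows "card X \<le> 2"
proof (rule ccontr)
  assume "\<not> ?thesis"
  then have "3 \<le> card X" by simp
  then obtain T where T: "T \<subseteq> X" "card T = 3" by (rule obtain_subset_with_card_n)
  then obtain x y z where "T = {x, y, z}" "x \<noteq> y" "y \<noteq> z" "x \<noteq> z"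
    by (auto simp: card_3_iff)
  with T(1) assms[of x y z] show False by auto
qed

text \<open>Bounds the core hyperedges through a pair, since all pairs of a core hyperedge are
  rich.\<close>

lemma card_rich_pages: "card {w \<in> link u v. rich u w \<and> rich v w} \<le> 2"
  by (rule card_le_twoI) (use three_rich_pages in blast)

lemma A_or_D_in_V:
  assumes "A u v \<or> D u v"
  shows "u \<in> V" "v \<in> V"
  using A_or_D_link[OF assms] link_distinct by blast+

lemma finite_link: "finite (link u v)"
  by (rule finite_subset[OF _ finite_V]) (use link_distinct(6) in blast)

text \<open>The bound is \<open>1 + 2\<close>: one path of type \<open>DD\<close> outside
  \<open>link a c\<close>, and two rich pages inside it.\<close>

lemma card_common_D:
  assumes "a \<noteq> c"
  shows "card {b. D a b \<and> D c b} \<le> 3"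
proof -
  have "{b. D a b \<and> D c b} \<subseteq>
      {b. b \<notin> link a c \<and> D a b \<and> D c b} \<union> {w \<in> link a c. rich a w \<and> rich c w}"
    using D_rich by blast
  moreover have "finite {b. b \<notin> link a c \<and> D a b \<and> D c b}"
    by (rule finite_subset[OF _ finite_V]) (use A_or_D_in_V in blast)
  ultimately have "card {b. D a b \<and> D c b} \<le>
      card ({b. b \<notin> link a c \<and> D a b \<and> D c b} \<union> {w \<in> link a c. rich a w \<and> rich c w})"
    using finite_link by (intro card_mono) auto
  also have "\<dots> \<le> card {b. b \<notin> link a c \<and> D a b \<and> D c b} + card {w \<in> link a c. rich a w \<and> rich c w}"
    by (rule card_Un_le)
  finally show ?thesis
    using card_paths_le_one(3)[OF assms] card_rich_pages[of a c] by linarith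
qed

text \<open>By \<open>A_link_unique\<close> no hyperedge contains two pairs of \<open>A\<close> that
  meet at \<open>b\<close>, so \<open>b \<notin> link a c\<close> is automatic.\<close>

lemma card_common_A:
  assumes "a \<noteq> c"
  shows "card {b. A a b \<and> A c b} \<le> 1"
proof -
  have "b \<notin> link a c" if "A a b" "A c b" for b
  proof
    assume "b \<in> link a c"
    then have "c \<in> link b a" using link_rotate by blast
    then show False using A_link_unique[of b a c] that A_sym by blast
  qed
  then have "{b. A a b \<and> A c b} = {b. b \<notin> link a c \<and> A a b \<and> A c b}" by blast
  then show ?thesis using card_paths_le_one(1)[OF assms] by simp
qed

section \<open>Double counting of hyperedges and weighted pairs\<close>

lemma card_triples:
  assumes "G \<subseteq> H"
  shows "card {(u, v, w). {u, v, w} \<in> G} = 6 * card G"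
proof -
  have fin: "finite G" using assms finite_H by (rule finite_subset)
  have six: "finite {(u, v, w). {u, v, w} = h} \<and> card {(u, v, w). {u, v, w} = h} = 6"
    if "h \<in> G" for h
  proof -
    have "card h = 3" using that assms edge_card by blast
    then obtain x y z where h: "h = {x, y, z}" and d: "x \<noteq> y" "y \<noteq> z" "x \<noteq> z"
      unfolding card_3_iff by blast
    have "{(u, v, w). {u, v, w} = h} =
        {(x, y, z), (x, z, y), (y, x, z), (y, z, x), (z, x, y), (z, y, x)}"
    proof (intro equalityI subsetI)
      fix t assume t: "t \<in> {(u, v, w). {u, v, w} = h}"
      obtain u v w where tt: "t = (u, v, w)" by (cases t)
      then have e: "{u, v, w} = {x, y, z}" using t h by simp
      then have "u \<in> {x, y, z}" "v \<in> {x, y, z}" "w \<in> {x, y, z}"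
        "x \<in> {u, v, w}" "y \<in> {u, v, w}" "z \<in> {u, v, w}" by blast+
      then show "t \<in> {(x, y, z), (x, z, y), (y, x, z), (y, z, x), (z, x, y), (z, y, x)}"
        using d unfolding tt by auto
    qed (auto simp: h)
    then show ?thesis using d by simp
  qed
  have "{(u, v, w). {u, v, w} \<in> G} = (\<Union>h\<in>G. {(u, v, w). {u, v, w} = h})" by auto
  also have "card \<dots> = (\<Sum>h\<in>G. card {(u, v, w). {u, v, w} = h})"
    using fin six by (intro card_UN_disjoint) auto
  also have "\<dots> = 6 * card G" using six by simp
  finally show ?thesis .
qed

lemma finite_triples: "finite {(u, v, w). {u, v, w} \<in> H}"
  by (rule finite_subset[of _ "V \<times> V \<times> V"]) (use finite_V edge_distinct in auto)

text \<open>A private pair determines its hyperedge through its link, and both of its orderings are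
  counted.\<close>

lemma card_A_pairs: "2 * card (H - core) \<le> card {(u, v). A u v}"
proof -
  have inj: "inj_on private_pair (H - core)"
  proof (rule inj_onI)
    fix g h assume gh: "g \<in> H - core" "h \<in> H - core" "private_pair g = private_pair h"
    obtain u v where uv: "private_pair h = (u, v)" by fastforce
    obtain w where "h = {u, v, w}" "link u v = {w}" using private_pairE[OF gh(2) uv] .
    moreover obtain x where "g = {u, v, x}" "link u v = {x}"
      using private_pairE[OF gh(1)] gh(3) uv by metis
    ultimately show "g = h" by simp
  qed
  let ?P = "private_pair ` (H - core)"
  \<comment> \<open>A private pair and its reversal would come from the same hyperedge, which makes
    the two entries equal.\<close>
  have disj: "?P \<inter> prod.swap ` ?P = {}"
  proof -
    have False if g: "g \<in> H - core" and h: "h \<in> H - core"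
      and eq: "private_pair g = prod.swap (private_pair h)" for g h
    proof -
      obtain u v where uv: "private_pair h = (u, v)" by fastforce
      obtain w where w: "h = {u, v, w}" "link u v = {w}" using private_pairE[OF h uv] .
      obtain x where x: "g = {v, u, x}" "link v u = {x}"
        using private_pairE[OF g] eq uv by auto
      have "x = w" using w(2) x(2) link_sym[of u v] by simp
      then have "g = h" unfolding w(1) x(1) by blast
      moreover have "private_pair g = (v, u)" using eq uv by simp
      ultimately have "u = v" using uv by (metis prod.inject)
      moreover have "{u, v, w} \<in> H" using h w(1) by simp
      ultimately show False using edge_distinct(1) by blast
    qed
    note no = this
    show ?thesis
    proof (rule equals0I)
      fix p assume p: "p \<in> ?P \<inter> prod.swap ` ?P"
      from p obtain g where "g \<in> H - core" "p = private_pair g" by blast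
      moreover from p obtain h where "h \<in> H - core" "p = prod.swap (private_pair h)" by blast
      ultimately show False using no[of g h] by simp
    qed
  qed
  have fin: "finite ?P" using finite_H by simp
  have "2 * card (H - core) = card ?P + card (prod.swap ` ?P)"
  proof -
    have "card (prod.swap ` ?P) = card ?P"
      by (rule card_image) (metis inj_onI swap_swap)
    then show ?thesis using card_image[OF inj] by linarith
  qed
  also have "\<dots> = card (?P \<union> prod.swap ` ?P)"
    using fin disj by (simp add: card_Un_disjoint)
  also have "\<dots> \<le> card {(u, v). A u v}"
  proof (rule card_mono)
    show "finite {(u, v). A u v}"
      by (rule finite_subset[of _ "V \<times> V"]) (use finite_V A_or_D_in_V in auto)
    show "?P \<union> prod.swap ` ?P \<subseteq> {(u, v). A u v}"
      unfolding A_def by (auto simp: prod_eq_iff)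
  qed
  finally show ?thesis .
qed

text \<open>A core hyperedge has six orderings, and an ordered pair has at most two completions to
  one.\<close>

lemma card_D_pairs: "3 * card core \<le> card {(u, v). D u v}"
proof -
  have sub: "core \<subseteq> H" by (auto simp: core_def)
  have fin: "finite {(u, v). D u v}"
    by (rule finite_subset[of _ "V \<times> V"]) (use finite_V A_or_D_in_V in auto)
  let ?W = "\<lambda>p. {w. {fst p, snd p, w} \<in> core}"
  have W: "finite (?W p)" "card (?W p) \<le> 2" for p
  proof -
    have s: "?W p \<subseteq> {w \<in> link (fst p) (snd p). rich (fst p) w \<and> rich (snd p) w}"
    proof
      fix w assume w: "w \<in> ?W p"
      then have "D (fst p) w" "D (snd p) w" 
        unfolding D_def mem_Collect_eq by (metis insert_commute)+
      then show "w \<in> {w \<in> link (fst p) (snd p). rich (fst p) w \<and> rich (snd p) w}"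
        using w sub D_rich unfolding link_def by auto
    qed
    have f: "finite {w \<in> link (fst p) (snd p). rich (fst p) w \<and> rich (snd p) w}"
      using finite_link by simp
    show "finite (?W p)" using s f by (rule finite_subset)
    show "card (?W p) \<le> 2" using card_mono[OF f s] card_rich_pages le_trans by blast
  qed
  have "6 * card core = card {(u, v, w). {u, v, w} \<in> core}" using card_triples[OF sub] by simp
  also have "\<dots> = card (SIGMA p:{(u, v). D u v}. ?W p)"
  proof (rule bij_betw_same_card)
    show "bij_betw (\<lambda>(u, v, w). ((u, v), w)) {(u, v, w). {u, v, w} \<in> core} (SIGMA p:{(u, v). D u v}. ?W p)"
      unfolding bij_betw_def inj_on_def D_def by (auto simp: image_iff)
  qed
  also have "\<dots> = (\<Sum>p\<in>{(u, v). D u v}. card (?W p))"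
    using fin W by (simp add: card_SigmaI)
  also have "\<dots> \<le> (\<Sum>p\<in>{(u, v). D u v}. 2)" using W by (intro sum_mono) auto
  finally show ?thesis by simp
qed

definition weight :: "'a \<Rightarrow> 'a \<Rightarrow> real" where
  "weight u v = of_bool (A u v) + 2 / 3 * of_bool (D u v)"

lemma weight_sym: "weight u v = weight v u"
  by (simp add: weight_def A_sym[of u v] D_sym[of u v])

lemma weight_nonneg: "0 \<le> weight u v"
  by (simp add: weight_def)

lemma weight_le_one: "weight u v \<le> 1"
  using A_not_D[of u v] by (auto simp: weight_def)

text \<open>Over ordered pairs, a hyperedge outside \<open>core\<close> accounts for
  \<open>2 * 1\<close> and a core hyperedge for \<open>3 * (2 / 3)\<close>; the weight
  \<open>2 / 3\<close> balances the two.\<close>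

lemma weight_sum: "2 * real (card H) \<le> (\<Sum>u\<in>V. \<Sum>v\<in>V. weight u v)"
proof -
  have c: "(\<Sum>u\<in>V. \<Sum>v\<in>V. of_bool (R u v)) = real (card {(u, v). R u v})"
    if "\<And>u v. R u v \<Longrightarrow> u \<in> V \<and> v \<in> V" for R :: "'a \<Rightarrow> 'a \<Rightarrow> bool"
  proof -
    have "{(u, v). u \<in> V \<and> v \<in> V \<and> R u v} = {(u, v). R u v}" using that by blast
    then show ?thesis using sum_of_bool_pairs[OF finite_V, of R] by simp
  qed
  have "(\<Sum>u\<in>V. \<Sum>v\<in>V. weight u v) = real (card {(u, v). A u v}) + 2 / 3 * real (card {(u, v). D u v})"
    using c[of A, OF conjI] c[of D, OF conjI] A_or_D_in_V(1)[OF disjI1] A_or_D_in_V(2)[OF disjI1]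
      A_or_D_in_V(1)[OF disjI2] A_or_D_in_V(2)[OF disjI2]
    by (simp add: weight_def sum.distrib del: times_divide_eq_left flip: sum_distrib_left)
  moreover have "card H = card (H - core) + card core"
    using finite_H card_Diff_subset[of core H] card_mono[of H core] finite_subset[of core H]
    by (force simp: core_def)
  ultimately show ?thesis using card_A_pairs card_D_pairs by linarith
qed

section \<open>Exceptional pairs joined by paths of conflicting types\<close>

definition mixed_A :: "'a \<Rightarrow> 'a \<Rightarrow> bool" where
  "mixed_A a c \<longleftrightarrow> (\<exists>b b'. b \<notin> link a c \<and> b' \<notin> link a c \<and>
     A a b \<and> A c b \<and> A a b' \<and> D c b')"

definition mixed_D :: "'a \<Rightarrow> 'a \<Rightarrow> bool" where
  "mixed_D a c \<longleftrightarrow> (\<exists>b b'. b \<notin> link a c \<and> b' \<notin> link a c \<and>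
     D a b \<and> D c b \<and> A a b' \<and> D c b')"

text \<open>The cases are \<open>AA\<close> with \<open>AD\<close>, \<open>AA\<close> with
  \<open>DA\<close>, \<open>DD\<close> with \<open>AD\<close>, and \<open>DD\<close> with
  \<open>DA\<close>; exchanging \<open>a\<close> and \<open>c\<close> swaps \<open>AD\<close> and
  \<open>DA\<close>.\<close>

definition mixed :: "'a \<Rightarrow> 'a \<Rightarrow> bool" where
  "mixed a c \<longleftrightarrow> a \<noteq> c \<and> (mixed_A a c \<or> mixed_A c a \<or> mixed_D a c \<or> mixed_D c a)"

text \<open>Charges exceptional pairs to ordered hyperedges, at most \<open>k\<close> to each of the
  six orderings.\<close>

lemma card_covered_by_triples:
  assumes "E \<subseteq> (\<Union>t\<in>{(u, v, w). {u, v, w} \<in> H}. F t)"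
    and "\<And>u v w. {u, v, w} \<in> H \<Longrightarrow> finite (F (u, v, w)) \<and> card (F (u, v, w)) \<le> k"
  shows "card E \<le> 6 * k * card H"
proof -
  let ?T = "{(u, v, w). {u, v, w} \<in> H}"
  have "card E \<le> card (\<Union>t\<in>?T. F t)"
    using assms finite_triples by (intro card_mono finite_UN_I) auto
  also have "\<dots> \<le> (\<Sum>t\<in>?T. card (F t))" by (rule card_UN_le[OF finite_triples])
  also have "\<dots> \<le> (\<Sum>t\<in>?T. k)" using assms(2) by (intro sum_mono) auto
  also have "\<dots> = 6 * k * card H" using card_triples[of H] by simp
  finally show ?thesis .
qed

text \<open>Only the alternative \<open>link c b = {b'}\<close> of \<open>two_paths\<close> fits the
  types. The hyperedge \<open>{c, b, b'}\<close> then leaves at most one \<open>a\<close>, a common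
  \<open>A\<close>-neighbour of \<open>b\<close> and \<open>b'\<close>.\<close>

lemma card_mixed_A: "card {(a, c). a \<noteq> c \<and> mixed_A a c} \<le> 6 * card H"
proof -
  let ?F = "\<lambda>(c, b, b'). (\<lambda>a. (a, c)) ` {a. A b a \<and> A b' a}"
  have "{(a, c). a \<noteq> c \<and> mixed_A a c} \<subseteq> (\<Union>t\<in>{(u, v, w). {u, v, w} \<in> H}. ?F t)"
  proof clarify
    fix a c assume ac: "a \<noteq> c" "mixed_A a c"
    then obtain b b' where b: "b \<notin> link a c" "b' \<notin> link a c" "A a b" "A c b" "A a b'" "D c b'"
      unfolding mixed_A_def by blast
    then have "b \<noteq> b'" using A_not_D by blast
    then have "link c b = {b'}" using two_paths[OF ac(1), of b b'] b A_not_D by blast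
    then have "{c, b, b'} \<in> H" by (auto simp: link_def)
    moreover have "(a, c) \<in> ?F (c, b, b')" using b A_sym by auto
    ultimately show "(a, c) \<in> (\<Union>t\<in>{(u, v, w). {u, v, w} \<in> H}. ?F t)" by blast
  qed
  moreover have "finite (?F (u, v, w)) \<and> card (?F (u, v, w)) \<le> 1" if "{u, v, w} \<in> H" for u v w
  proof -
    have f: "finite {a. A v a \<and> A w a}"
      by (rule finite_subset[OF _ finite_V]) (use A_or_D_in_V in blast)
    show ?thesis
      using f card_image_le[OF f, of "\<lambda>a. (a, u)"] card_common_A[of v w] edge_distinct(3)[OF that] by simp
  qed
  ultimately have "card {(a, c). a \<noteq> c \<and> mixed_A a c} \<le> 6 * 1 * card H"
    by (intro card_covered_by_triples) auto
  then show ?thesis by simp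
qed

text \<open>Here \<open>two_paths\<close> forces \<open>link a b' = {b}\<close>, and
  \<open>c\<close> is one of at most three common \<open>D\<close>-neighbours of \<open>b\<close>
  and \<open>b'\<close>.\<close>

lemma card_mixed_D: "card {(a, c). a \<noteq> c \<and> mixed_D a c} \<le> 18 * card H"
proof -
  let ?F = "\<lambda>(a, b, b'). Pair a ` {c. D b c \<and> D b' c}"
  have "{(a, c). a \<noteq> c \<and> mixed_D a c} \<subseteq> (\<Union>t\<in>{(u, v, w). {u, v, w} \<in> H}. ?F t)"
  proof clarify
    fix a c assume ac: "a \<noteq> c" "mixed_D a c"
    then obtain b b' where b: "b \<notin> link a c" "b' \<notin> link a c" "D a b" "D c b" "A a b'" "D c b'"
      unfolding mixed_D_def by blast
    then have "b \<noteq> b'" using A_not_D by blast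
    then have "link a b' = {b}" using two_paths[OF ac(1), of b b'] b A_not_D by blast
    then have "{a, b', b} \<in> H" by (auto simp: link_def)
    moreover have "(a, c) \<in> ?F (a, b', b)" using b D_sym by auto
    ultimately show "(a, c) \<in> (\<Union>t\<in>{(u, v, w). {u, v, w} \<in> H}. ?F t)" by blast
  qed
  moreover have "finite (?F (u, v, w)) \<and> card (?F (u, v, w)) \<le> 3" if "{u, v, w} \<in> H" for u v w
  proof -
    have f: "finite {c. D v c \<and> D w c}"
      by (rule finite_subset[OF _ finite_V]) (use A_or_D_in_V in blast)
    show ?thesis
      using f card_image_le[OF f, of "Pair u"] card_common_D[of v w] edge_distinct(3)[OF that] by simp
  qed
  ultimately have "card {(a, c). a \<noteq> c \<and> mixed_D a c} \<le> 6 * 3 * card H"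
    by (intro card_covered_by_triples) auto
  then show ?thesis by simp
qed

text \<open>The constant is \<open>2 * (6 + 18)\<close>, doubled for the exchange of
  \<open>a\<close> and \<open>c\<close>.\<close>

lemma card_mixed: "card {(a, c). mixed a c} \<le> 48 * card H"
proof -
  let ?X = "{(a, c). a \<noteq> c \<and> mixed_A a c}" and ?Y = "{(a, c). a \<noteq> c \<and> mixed_D a c}"
  have fin: "finite ?X" "finite ?Y"
    by (rule finite_subset[of _ "V \<times> V"],
        use finite_V A_or_D_in_V in \<open>auto simp: mixed_A_def mixed_D_def\<close>)+
  have "{(a, c). mixed a c} \<subseteq> (?X \<union> prod.swap ` ?X) \<union> (?Y \<union> prod.swap ` ?Y)"
    unfolding mixed_def by force
  then have "card {(a, c). mixed a c} \<le> card ((?X \<union> prod.swap ` ?X) \<union> (?Y \<union> prod.swap ` ?Y))"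
    using fin by (intro card_mono) auto
  also have "\<dots> \<le> (card ?X + card (prod.swap ` ?X)) + (card ?Y + card (prod.swap ` ?Y))"
    by (meson add_mono card_Un_le le_trans)
  also have "\<dots> \<le> (card ?X + card ?X) + (card ?Y + card ?Y)"
    using card_image_le fin by (intro add_mono) auto
  finally show ?thesis using card_mixed_A card_mixed_D by linarith
qed

section \<open>Weighted paths between two vertices\<close>

lemma path_weight:
  assumes "a \<noteq> c"
  shows "(\<Sum>b\<in>V - link a c. weight a b * weight c b) \<le> 13 / 9 + 4 * of_bool (mixed a c)"
proof -
  define AA where "AA = {b. b \<notin> link a c \<and> A a b \<and> A c b}"
  define AD where "AD = {b. b \<notin> link a c \<and> A a b \<and> D c b}"
  define DA where "DA = {b. b \<notin> link a c \<and> D a b \<and> A c b}"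
  define DD where "DD = {b. b \<notin> link a c \<and> D a b \<and> D c b}"
  have DA': "DA = {b. b \<notin> link c a \<and> A c b \<and> D a b}"
    unfolding DA_def using link_sym[of a c] by auto
  have le1: "card AA \<le> 1" "card AD \<le> 1" "card DA \<le> 1" "card DD \<le> 1"
    using card_paths_le_one[OF assms] card_paths_le_one(2)[of c a] assms
    unfolding AA_def AD_def DA' DD_def by auto
  have c: "(\<Sum>b\<in>V - link a c. of_bool (b \<in> X)) = real (card X)" if "X \<subseteq> V - link a c" for X
    using finite_V that by (simp add: Int_absorb1 Collect_mem_eq)
  have sub: "AA \<subseteq> V - link a c" "AD \<subseteq> V - link a c" "DA \<subseteq> V - link a c" "DD \<subseteq> V - link a c"
    unfolding AA_def AD_def DA_def DD_def using A_or_D_in_V by auto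
  have "(\<Sum>b\<in>V - link a c. weight a b * weight c b) = (\<Sum>b\<in>V - link a c.
      of_bool (b \<in> AA) + 2 / 3 * of_bool (b \<in> AD) + 2 / 3 * of_bool (b \<in> DA) + 4 / 9 * of_bool (b \<in> DD))"
    by (rule sum.cong)
      (auto simp: weight_def AA_def AD_def DA_def DD_def of_bool_def dest: A_not_D)
  also have "\<dots> = card AA + 2 / 3 * card AD + 2 / 3 * card DA + 4 / 9 * card DD"
    by (simp only: sum.distrib flip: sum_distrib_left) (simp only: c[OF sub(1)] c[OF sub(2)] c[OF sub(3)] c[OF sub(4)])
  finally have eq: "(\<Sum>b\<in>V - link a c. weight a b * weight c b) =
      card AA + 2 / 3 * card AD + 2 / 3 * card DA + 4 / 9 * card DD" .
  show ?thesis
  proof (cases "mixed a c")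
    case True
    \<comment> \<open>One path of each type weighs \<open>25 / 9\<close> in total, well below
      \<open>13 / 9 + 4\<close>.\<close>
    then show ?thesis unfolding eq using le1 by simp
  next
    case False
    then have no: "\<not> mixed_A a c" "\<not> mixed_A c a" "\<not> mixed_D a c" "\<not> mixed_D c a"
      using assms by (auto simp: mixed_def)
    have "AA = {} \<or> AD = {}" using no(1) unfolding mixed_A_def AA_def AD_def by blast
    moreover have "AA = {} \<or> DA = {}"
      using no(2) unfolding mixed_A_def AA_def DA_def link_sym[of c a] by blast
    moreover have "DD = {} \<or> AD = {}" using no(3) unfolding mixed_D_def DD_def AD_def by blast
    moreover have "DD = {} \<or> DA = {}"
      using no(4) unfolding mixed_D_def DD_def DA_def link_sym[of c a] by blast
    \<comment> \<open>If a mixed type occurs, \<open>AA\<close> and \<open>DD\<close> are empty and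
      the total is at most \<open>4 / 3\<close>; otherwise it is at most
      \<open>1 + 4 / 9\<close>.\<close>
    ultimately have "card AA + card AD \<le> 1" "card AA + card DA \<le> 1"
      "card DD + card AD \<le> 1" "card DD + card DA \<le> 1"
      using le1 by auto
    then show ?thesis unfolding eq using False by simp
  qed
qed

section \<open>Second moment of the weighted degree and the explicit bound\<close>

lemma weight_sum_square:
  "(\<Sum>u\<in>V. \<Sum>v\<in>V. weight u v)\<^sup>2 \<le>
    13 / 9 * real (card V) ^ 3 + 100 * real (card V) * (\<Sum>u\<in>V. \<Sum>v\<in>V. weight u v)"
proof -
  let ?S = "\<Sum>u\<in>V. \<Sum>v\<in>V. weight u v" and ?n = "real (card V)"
  \<comment> \<open>Off the diagonal, each middle vertex in \<open>link a c\<close> costs at most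
    \<open>1\<close>; on it, the sum is at most the weighted degree.\<close>
  have pair: "(\<Sum>b\<in>V. weight a b * weight c b) \<le>
      13 / 9 + 4 * of_bool (mixed a c) + card (link a c) + (if a = c then \<Sum>b\<in>V. weight a b else 0)"
    for a c
  proof (cases "a = c")
    case True
    have "(\<Sum>b\<in>V. weight a b * weight c b) \<le> (\<Sum>b\<in>V. weight a b)"
      using weight_nonneg weight_le_one by (intro sum_mono) (simp add: mult_left_le)
    then show ?thesis using True by simp
  next
    case False
    have s: "link a c \<subseteq> V" using link_distinct(6) by blast
    have "(\<Sum>b\<in>V. weight a b * weight c b) =
        (\<Sum>b\<in>V - link a c. weight a b * weight c b) + (\<Sum>b\<in>link a c. weight a b * weight c b)"
      using finite_V s by (rule sum.subset_diff[rotated])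
    moreover have "(\<Sum>b\<in>link a c. weight a b * weight c b) \<le> (\<Sum>b\<in>link a c. 1)"
      using weight_nonneg weight_le_one by (intro sum_mono) (simp add: mult_le_one)
    ultimately show ?thesis using path_weight[OF False] False by simp
  qed
  have links: "(\<Sum>a\<in>V. \<Sum>c\<in>V. real (card (link a c))) = 6 * card H"
  proof -
    have "card {(u, v, w). {u, v, w} \<in> H} = card (SIGMA a:V. SIGMA c:V. link a c)"
      by (rule arg_cong[of _ _ card]) (auto simp: link_def edge_distinct)
    also have "\<dots> = (\<Sum>a\<in>V. \<Sum>c\<in>V. card (link a c))"
      using finite_V finite_link by (simp add: card_SigmaI)
    finally show ?thesis using card_triples[of H] by (simp flip: of_nat_sum)
  qed
  have mix: "(\<Sum>a\<in>V. \<Sum>c\<in>V. of_bool (mixed a c)) \<le> 48 * real (card H)"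
  proof -
    have "{(a, c). a \<in> V \<and> c \<in> V \<and> mixed a c} = {(a, c). mixed a c}"
      using A_or_D_in_V by (auto simp: mixed_def mixed_A_def mixed_D_def)
    then have "(\<Sum>a\<in>V. \<Sum>c\<in>V. of_bool (mixed a c)) = real (card {(a, c). mixed a c})"
      using sum_of_bool_pairs[OF finite_V, of mixed] by simp
    then show ?thesis using card_mixed by simp
  qed
  have "(\<Sum>b\<in>V. (\<Sum>a\<in>V. weight b a)\<^sup>2) = (\<Sum>b\<in>V. \<Sum>a\<in>V. \<Sum>c\<in>V. weight a b * weight c b)"
    unfolding power2_eq_square sum_product by (intro sum.cong refl) (metis weight_sym)
  also have "\<dots> = (\<Sum>a\<in>V. \<Sum>b\<in>V. \<Sum>c\<in>V. weight a b * weight c b)"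
    by (rule sum.swap)
  also have "\<dots> = (\<Sum>a\<in>V. \<Sum>c\<in>V. \<Sum>b\<in>V. weight a b * weight c b)"
    by (rule sum.cong[OF refl], rule sum.swap)
  also have "\<dots> \<le> (\<Sum>a\<in>V. \<Sum>c\<in>V. 13 / 9 + 4 * of_bool (mixed a c) + card (link a c) +
      (if a = c then \<Sum>b\<in>V. weight a b else 0))"
    by (intro sum_mono pair)
  also have "\<dots> = 13 / 9 * ?n\<^sup>2 + 4 * (\<Sum>a\<in>V. \<Sum>c\<in>V. of_bool (mixed a c)) + 6 * card H + ?S"
    using finite_V links by (simp add: sum.distrib power2_eq_square flip: sum_distrib_left)
  \<comment> \<open>The multiple of \<open>card H\<close> is \<open>4 * 48 + 6 = 198\<close>, and
    \<open>weight_sum\<close> bounds that term by \<open>99 * ?S\<close>.\<close>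
  also have "\<dots> \<le> 13 / 9 * ?n\<^sup>2 + 100 * ?S"
    using mix weight_sum by linarith
  finally have sq: "(\<Sum>b\<in>V. (\<Sum>a\<in>V. weight b a)\<^sup>2) \<le> 13 / 9 * ?n\<^sup>2 + 100 * ?S" .
  have "?S\<^sup>2 \<le> (\<Sum>b\<in>V. (\<Sum>a\<in>V. weight b a)\<^sup>2) * ?n"
    using sum_squared_le_sum_of_squares[of "\<lambda>b. \<Sum>a\<in>V. weight b a" V] finite_V by (simp add: mult.commute)
  also have "\<dots> \<le> (13 / 9 * ?n\<^sup>2 + 100 * ?S) * ?n"
    using sq by (rule mult_right_mono) simp
  finally show ?thesis by (simp add: algebra_simps power2_eq_square power3_eq_cube)
qed

lemma card_bound:
  "real (card H) \<le> (1 + sqrt 2) / 4 * (real (card V) * sqrt (real (card V))) + 50 * real (card V)"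
proof -
  define S where "S = (\<Sum>u\<in>V. \<Sum>v\<in>V. weight u v)"
  define n where "n = real (card V)"
  define t where "t = (1 + sqrt 2) / 2 * (n * sqrt n)"
  have n: "0 \<le> n" by (simp add: n_def)
  have t: "0 \<le> t" using n by (simp add: t_def)
  have c: "13 / 9 \<le> ((1 + sqrt 2) / 2)\<^sup>2"
  proof -
    \<comment> \<open>Expanding the square shows that the claim is equivalent to this bound.\<close>
    have "25 / 18 \<le> sqrt 2" by (rule real_le_rsqrt) (simp add: power2_eq_square)
    then show ?thesis by (simp add: power2_eq_square field_simps)
  qed
  have "13 / 9 * n ^ 3 \<le> ((1 + sqrt 2) / 2)\<^sup>2 * n ^ 3"
    using c n by (intro mult_right_mono) auto
  also have "\<dots> = t\<^sup>2"
    using n by (simp add: t_def power_mult_distrib power3_eq_cube power2_eq_square)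
  finally have sq: "S\<^sup>2 \<le> t\<^sup>2 + 100 * n * S"
    using weight_sum_square unfolding S_def n_def by linarith
  have "S \<le> t + 100 * n"
  proof (rule ccontr)
    assume "\<not> ?thesis"
    \<comment> \<open>Both \<open>S\<close> and \<open>S - 100 * n\<close> exceed \<open>t\<close>,
      so their product exceeds \<open>t\<^sup>2\<close>, against \<open>sq\<close>.\<close>
    then have l: "t < S - 100 * n" by simp
    have "t * t \<le> (S - 100 * n) * (S - 100 * n)" using l t by (intro mult_mono) auto
    moreover have "t < S" using l n by simp
    have "t\<^sup>2 < S * (S - 100 * n)"
      unfolding power2_eq_square using l t \<open>t < S\<close> by (intro mult_strict_mono') auto
    then show False using sq by (simp add: algebra_simps power2_eq_square)
  qed
  then show ?thesis using weight_sum unfolding S_def[symmetric] n_def[symmetric] t_def by simp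
qed

end

section \<open>The extremal number and the asymptotic bound\<close>

lemma ex_Tr_C4_attained:
  obtains H :: "nat set set" where "ex_Tr_C4 r n = card H"
    "uniform_hypergraph r {..<n} H" "\<not> contains_Tr_C4 H"
proof -
  let ?C = "{card H | H :: nat set set. uniform_hypergraph r {..<n} H \<and> \<not> contains_Tr_C4 H}"
  have "?C \<subseteq> card ` Pow (Pow {..<n})"
    by (auto simp: uniform_hypergraph_def)
  then have "finite ?C" by (rule finite_subset) simp
  \<comment> \<open>The empty hypergraph makes the set nonempty, so that \<open>Max\<close> is
    attained.\<close>
  moreover have "card ({} :: nat set set) \<in> ?C"
    unfolding uniform_hypergraph_def contains_Tr_C4_def by blast
  ultimately have "Max ?C \<in> ?C" by (intro Max_in) auto
  then show thesis using that unfolding ex_Tr_C4_def by blast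
qed

theorem theorem2:
  shows "\<forall>\<epsilon>>0. \<exists>N. \<forall>n\<ge>N.
    real (ex_Tr_C4 3 n) \<le> ((1 + sqrt 2) / 4 + \<epsilon>) * real n powr (3/2)"
proof (intro allI impI)
  fix \<epsilon> :: real assume eps: "\<epsilon> > 0"
  \<comment> \<open>Makes \<open>sqrt n\<close> at least \<open>50 / \<epsilon>\<close>, so the
    linear term \<open>50 * n\<close> is absorbed.\<close>
  obtain N :: nat where N: "(50 / \<epsilon>)\<^sup>2 < real N" using reals_Archimedean2 by blast
  have "real (ex_Tr_C4 3 n) \<le> ((1 + sqrt 2) / 4 + \<epsilon>) * real n powr (3/2)" if "n \<ge> N" for n
  proof -
    obtain H :: "nat set set" where H: "ex_Tr_C4 3 n = card H"
      "uniform_hypergraph 3 {..<n} H" "\<not> contains_Tr_C4 H"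
      by (rule ex_Tr_C4_attained)
    interpret trace_free "{..<n}" H by unfold_locales (use H in auto)
    have p: "real n powr (3/2) = real n * sqrt (real n)"
    proof (cases "n = 0")
      case False
      have "real n powr (3/2) = real n powr 1 * real n powr (1/2)"
        using powr_add[of "real n" 1 "1/2"] by simp
      then show ?thesis using False by (simp add: powr_half_sqrt[of "real n", symmetric])
    qed simp
    have "50 / \<epsilon> \<le> sqrt (real n)"
      by (rule real_le_rsqrt) (use N that in linarith)
    then have "50 \<le> \<epsilon> * sqrt (real n)" using eps by (simp add: field_simps)
    then have "50 * real n \<le> \<epsilon> * (real n * sqrt (real n))"
      using mult_right_mono[of 50 "\<epsilon> * sqrt (real n)" "real n"] by (simp add: mult_ac)
    then show ?thesis using card_bound unfolding H(1) p by (simp add: algebra_simps)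
  qed
  then show "\<exists>N. \<forall>n\<ge>N. real (ex_Tr_C4 3 n) \<le> ((1 + sqrt 2) / 4 + \<epsilon>) * real n powr (3/2)"
    by blast
qed

end
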